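(* Let $X=\sum_{i=1}^n x_i$ be a sum of independent real random variables, and denote $F(t)=\Pr[X>t]$. Set $m=\max_{i\in\{1,\dots,n\}}\{\sup x_i-\inf x_i\}$. For any real numbers $b\le c\le d$, we have $$F(d)\,F(b)\;\le\; F(c)\,F(b+d-c-m).$$
   Context: $\sup x_i$ and $\inf x_i$ denote the supremum and infimum of the values taken by the random variable $x_i$. If $m=+\infty$, then $F(-\infty)$ is interpreted as $1$. *)

theory Defs
  imports "HOL-Probability.Probability"
begin

text \<open>
  The argument of the tail function is extended real, so that the convention that the tail at
  minus infinity is 1 needs no separate clause (lemma \<open>upper_tail_MInf\<close> below).
\<close>

definition upper_tail :: "'a measure \<Rightarrow> ('a \<Rightarrow> real) \<Rightarrow> ereal \<Rightarrow> real" where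
  "upper_tail M X t = measure M {\<omega> \<in> space M. ereal (X \<omega>) > t}"

lemma (in prob_space) upper_tail_MInf: "upper_tail M X (-\<infinity>) = 1"
  by (simp add: upper_tail_def prob_space)

lemma upper_tail_ereal: "upper_tail M X (ereal t) = measure M {\<omega> \<in> space M. X \<omega> > t}"
  by (simp add: upper_tail_def)

text \<open>
  Supremum minus infimum of the values taken on the sample space (not their essential versions).
  On a nonempty sample space the supremum is not minus infinity and the infimum is not plus
  infinity, so the difference is never of the indeterminate form.
\<close>

definition value_range :: "'a measure \<Rightarrow> ('a \<Rightarrow> real) \<Rightarrow> ereal" where
  "value_range M X = (SUP \<omega>\<in>space M. ereal (X \<omega>)) - (INF \<omega>\<in>space M. ereal (X \<omega>))"

end

theory Submission
  imports Defs
begin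

text \<open>
  The inequality is preserved when an independent summand of bounded range is added, so it
  follows by induction on the number of summands.

  Let \<open>Y\<close> be the new summand, \<open>S\<close> the sum of the others, and \<open>G\<close> the tail of \<open>S\<close>. By independence
  the tail of \<open>Y + S\<close> is \<open>F t = E (G (t - Y))\<close>, so both sides of the inequality are expectations
  over two independent copies of \<open>Y\<close>, and it is enough to compare the integrands for each pair
  \<open>y\<close>, \<open>y'\<close> of values of \<open>Y\<close>:
  \<open>G (d - y) * G (b - y') \<le> G (c - y) * G (b + d - c - m - y')\<close>.
  If \<open>y - y' \<le> c - b\<close>, then \<open>b - y' \<le> c - y \<le> d - y\<close> and this is the inequality for \<open>G\<close>.
  Otherwise \<open>c - b < y - y' \<le> m\<close>, so that \<open>c - y \<le> b - y'\<close> and, since \<open>b \<le> c\<close>, also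
  \<open>b + d - c - m - y' \<le> d - y\<close>; then monotonicity of \<open>G\<close> bounds each factor on the left by
  one on the right.

  Unfolding the induction gives a coupling: for two independent copies of the sum, one stops
  at the first index where the partial sums differ by more than \<open>c - b\<close>, and exchanges all the
  later summands. A single step changes the difference by at most \<open>m\<close>, which is the loss in the
  last argument of \<open>F\<close>. If \<open>m\<close> is infinite the right-hand side is \<open>F c\<close>, and there is nothing
  to prove.
\<close>

lemma (in finite_measure) upper_tail_antimono:
  assumes "X \<in> borel_measurable M" "s \<le> t"
  shows "upper_tail M X t \<le> upper_tail M X s"
  unfolding upper_tail_def using assms by (intro finite_measure_mono) auto

lemma (in prob_space) upper_tail_le_1: "upper_tail M X t \<le> 1"
  unfolding upper_tail_def by (rule prob_le_1)

lemma (in prob_space) borel_measurable_upper_tail_shift: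
  assumes "S \<in> borel_measurable M"
  shows "(\<lambda>y. upper_tail M S (ereal (t - y))) \<in> borel_measurable borel"
  by (intro borel_measurable_mono monoI upper_tail_antimono assms) auto

lemma (in prob_space) integrable_upper_tail_shift:
  assumes "Y \<in> borel_measurable M" "S \<in> borel_measurable M"
  shows "integrable M (\<lambda>\<omega>. upper_tail M S (ereal (t - Y \<omega>)))"
proof (rule integrable_const_bound[where B = 1])
  show "(\<lambda>\<omega>. upper_tail M S (ereal (t - Y \<omega>))) \<in> borel_measurable M"
    using measurable_compose[OF assms(1) borel_measurable_upper_tail_shift[OF assms(2)]] .
  show "AE \<omega> in M. norm (upper_tail M S (ereal (t - Y \<omega>))) \<le> 1"
    by (simp add: upper_tail_def)
qed

lemma (in prob_space) upper_tail_indep_add: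
  assumes indep: "indep_var borel Y borel S"
  shows "upper_tail M (\<lambda>\<omega>. Y \<omega> + S \<omega>) (ereal t) = (\<integral>\<omega>. upper_tail M S (ereal (t - Y \<omega>)) \<partial>M)"
proof -
  have rv [measurable]: "Y \<in> borel_measurable M" "S \<in> borel_measurable M"
    using indep by (auto dest: indep_var_rv1 indep_var_rv2)
  interpret DY: prob_space "distr M borel Y" by (rule prob_space_distr) measurable
  interpret DS: prob_space "distr M borel S" by (rule prob_space_distr) measurable
  have tail_S: "emeasure (distr M borel S) {s. s + y \<in> {t<..}} = ennreal (upper_tail M S (ereal (t - y)))"
    for y
    by (subst emeasure_distr)
       (auto simp: upper_tail_def emeasure_eq_measure intro!: arg_cong[where f = prob])
  have "ennreal (upper_tail M (\<lambda>\<omega>. Y \<omega> + S \<omega>) (ereal t))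
    = emeasure (distr M borel (\<lambda>\<omega>. Y \<omega> + S \<omega>)) {t<..}"
    by (subst emeasure_distr)
       (auto simp: upper_tail_def emeasure_eq_measure intro!: arg_cong[where f = prob])
  also have "\<dots> = (\<integral>\<^sup>+y. emeasure (distr M borel S) {s. s + y \<in> {t<..}} \<partial>distr M borel Y)"
    unfolding sum_indep_random_variable[OF indep rv]
    by (rule convolution_emeasure)
       (simp_all add: DY.finite_measure_axioms DS.finite_measure_axioms)
  also have "\<dots> = (\<integral>\<^sup>+\<omega>. ennreal (upper_tail M S (ereal (t - Y \<omega>))) \<partial>M)"
    unfolding tail_S
    by (rule nn_integral_distr)
       (auto intro: measurable_compose[OF borel_measurable_upper_tail_shift[OF rv(2)] measurable_ennreal])
  also have "\<dots> = ennreal (\<integral>\<omega>. upper_tail M S (ereal (t - Y \<omega>)) \<partial>M)"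
    using integrable_upper_tail_shift[OF rv]
    by (rule nn_integral_eq_integral) (simp add: upper_tail_def)
  finally show ?thesis
    by (subst (asm) ennreal_inj) (auto intro!: integral_nonneg_AE simp: upper_tail_def)
qed

text \<open>
  Each side is an expectation over two independent copies of the sample space. Integrating out
  one variable at a time avoids the product measure.
\<close>

lemma integral_product_mono:
  fixes f f' g g' :: "'a \<Rightarrow> real"
  assumes [simp]: "integrable M f" "integrable M f'" "integrable M g" "integrable M g'"
    and le: "\<And>u v. u \<in> space M \<Longrightarrow> v \<in> space M \<Longrightarrow> f u * g v \<le> f' u * g' v"
  shows "integral\<^sup>L M f * integral\<^sup>L M g \<le> integral\<^sup>L M f' * integral\<^sup>L M g'"
proof -
  have "f u * integral\<^sup>L M g \<le> f' u * integral\<^sup>L M g'" if "u \<in> space M" for u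
    using integral_mono[of M "\<lambda>v. f u * g v" "\<lambda>v. f' u * g' v"] le that by simp
  then show ?thesis
    using integral_mono[of M "\<lambda>u. f u * integral\<^sup>L M g" "\<lambda>u. f' u * integral\<^sup>L M g'"] by simp
qed

text \<open>
  The induction step. The inequality for \<open>S\<close> has to be available for all triples, since it is
  applied to the shifted arguments \<open>b - Y v\<close>, \<open>c - Y u\<close> and \<open>d - Y u\<close>: the smallest one belongs
  to the second copy, and the other two, whose order is unaffected, to the first.
\<close>

lemma (in prob_space) tail_inequality_indep_add:
  fixes b c d m :: real
  assumes indep: "indep_var borel Y borel S"
    and range: "\<And>u v. u \<in> space M \<Longrightarrow> v \<in> space M \<Longrightarrow> Y u - Y v \<le> m"
    and S_ineq: "\<And>b c d :: real. b \<le> c \<Longrightarrow> c \<le> d \<Longrightarrow>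
      upper_tail M S (ereal d) * upper_tail M S (ereal b)
      \<le> upper_tail M S (ereal c) * upper_tail M S (ereal (b + d - c - m))"
    and "b \<le> c" "c \<le> d"
  shows "upper_tail M (\<lambda>\<omega>. Y \<omega> + S \<omega>) (ereal d)
      * upper_tail M (\<lambda>\<omega>. Y \<omega> + S \<omega>) (ereal b)
    \<le> upper_tail M (\<lambda>\<omega>. Y \<omega> + S \<omega>) (ereal c)
      * upper_tail M (\<lambda>\<omega>. Y \<omega> + S \<omega>) (ereal (b + d - c - m))"
proof -
  have [measurable]: "Y \<in> borel_measurable M" "S \<in> borel_measurable M"
    using indep by (auto dest: indep_var_rv1 indep_var_rv2)
  define G where "G t = upper_tail M S (ereal t)" for t
  have G_mono: "s \<le> t \<Longrightarrow> G t \<le> G s" for s t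
    unfolding G_def by (rule upper_tail_antimono) auto
  have G_nonneg: "0 \<le> G t" for t
    by (simp add: G_def upper_tail_def)
  have "G (d - Y u) * G (b - Y v) \<le> G (c - Y u) * G (b + d - c - m - Y v)"
    if "u \<in> space M" "v \<in> space M" for u v
  proof (cases "Y u - Y v \<le> c - b")
    case True
    have "b - Y v + (d - Y u) - (c - Y u) - m = b + d - c - m - Y v"
      by simp
    note S_ineq[of "b - Y v" "c - Y u" "d - Y u", unfolded this]
    then show ?thesis
      unfolding G_def using True \<open>c \<le> d\<close> by auto
  next
    case False
    then have "G (b - Y v) \<le> G (c - Y u)" "G (d - Y u) \<le> G (b + d - c - m - Y v)"
      using range[OF that] \<open>b \<le> c\<close> by (auto intro!: G_mono)
    then show ?thesis
      by (subst mult.commute) (intro mult_mono G_nonneg)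
  qed
  then have "(\<integral>\<omega>. G (d - Y \<omega>) \<partial>M) * (\<integral>\<omega>. G (b - Y \<omega>) \<partial>M)
    \<le> (\<integral>\<omega>. G (c - Y \<omega>) \<partial>M) * (\<integral>\<omega>. G (b + d - c - m - Y \<omega>) \<partial>M)"
    unfolding G_def by (intro integral_product_mono integrable_upper_tail_shift) auto
  then show ?thesis
    by (simp add: G_def upper_tail_indep_add[OF indep])
qed

lemma (in prob_space) tail_inequality_indep_sum:
  fixes b c d m :: real and x :: "'i \<Rightarrow> 'a \<Rightarrow> real"
  assumes "finite I" "indep_vars (\<lambda>_. borel) x I" "0 \<le> m"
    and "\<And>i u v. i \<in> I \<Longrightarrow> u \<in> space M \<Longrightarrow> v \<in> space M \<Longrightarrow> x i u - x i v \<le> m"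
    and "b \<le> c" "c \<le> d"
  shows "upper_tail M (\<lambda>\<omega>. \<Sum>i\<in>I. x i \<omega>) (ereal d)
      * upper_tail M (\<lambda>\<omega>. \<Sum>i\<in>I. x i \<omega>) (ereal b)
    \<le> upper_tail M (\<lambda>\<omega>. \<Sum>i\<in>I. x i \<omega>) (ereal c)
      * upper_tail M (\<lambda>\<omega>. \<Sum>i\<in>I. x i \<omega>) (ereal (b + d - c - m))"
  using assms
proof (induction I arbitrary: b c d rule: finite_induct)
  case empty
  \<comment> \<open>The empty sum is 0, with tail the indicator of the negative numbers.\<close>
  then show ?case
    by (cases "d < 0") (auto simp: upper_tail_ereal prob_space)
next
  case (insert i I)
  have indep: "indep_vars (\<lambda>_. borel) x I"
    using insert.prems(1) by (rule indep_vars_subset) auto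
  have "indep_var borel (x i) borel (\<lambda>\<omega>. \<Sum>j\<in>I. x j \<omega>)"
    using insert.hyps insert.prems(1) by (rule indep_vars_sum)
  then show ?case
    unfolding sum.insert[OF insert.hyps]
    by (rule tail_inequality_indep_add) (use insert indep in auto)
qed

text \<open>
  This connects the extended real range with the pointwise bound on differences. The case
  \<open>u = v\<close> shows that the range is nonnegative.
\<close>

lemma diff_le_value_range:
  assumes "u \<in> space M" "v \<in> space M"
  shows "ereal (X u - X v) \<le> value_range M X"
  unfolding value_range_def ereal_minus(1)[symmetric]
  using assms by (intro ereal_minus_mono SUP_upper INF_lower)

theorem lemma1p13:
  fixes M :: "'a measure" and x :: "nat \<Rightarrow> 'a \<Rightarrow> real" and n :: nat
    and X :: "'a \<Rightarrow> real" and F :: "ereal \<Rightarrow> real" and m :: ereal and b c d :: real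
  assumes "prob_space M"
    and "n \<ge> 1"
    and "prob_space.indep_vars M (\<lambda>_. borel) x {1..n}"
    and "X = (\<lambda>\<omega>. \<Sum>i=1..n. x i \<omega>)"
    and "F = upper_tail M X"
    and "m = Max ((\<lambda>i. value_range M (x i)) ` {1..n})"
    and "b \<le> c" and "c \<le> d"
  shows "F (ereal d) * F (ereal b) \<le> F (ereal c) * F (ereal (b + d - c) - m)"
proof -
  interpret prob_space M by fact
  have range: "ereal (x i u - x i v) \<le> m"
    if "i \<in> {1..n}" "u \<in> space M" "v \<in> space M" for i u v
  proof -
    have "value_range M (x i) \<le> m"
      unfolding assms(6) using that by (intro Max_ge) auto
    then show ?thesis
      using diff_le_value_range[of u M v "x i"] that by (meson order_trans)
  qed
  obtain \<omega> where "\<omega> \<in> space M"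
    using not_empty by auto
  then have "0 \<le> m"
    using range[of 1 \<omega> \<omega>] \<open>n \<ge> 1\<close> by (simp add: zero_ereal_def)
  then consider r where "m = ereal r" "0 \<le> r" | "m = \<infinity>"
    by (cases m) auto
  then show ?thesis
  proof cases
    case 1
    then show ?thesis
      using tail_inequality_indep_sum[of "{1..n}" x r b c d] assms range by auto
  next
    case 2
    have "X \<in> borel_measurable M"
      using assms(3) unfolding assms(4) indep_vars_def by (intro borel_measurable_sum) auto
    then have "F (ereal d) \<le> F (ereal c)"
      unfolding assms(5) using \<open>c \<le> d\<close> by (intro upper_tail_antimono) auto
    moreover have "F (ereal d) * F (ereal b) \<le> F (ereal d)"
      unfolding assms(5) using upper_tail_le_1
      by (intro mult_left_le) (auto simp: upper_tail_def)
    ultimately show ?thesis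
      using 2 by (simp add: assms(5) upper_tail_MInf)
  qed
qed

end
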